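(* Let $P=\{y_1,\ldots,y_d\}$ be a finite partially ordered set with $d\ge 1$ elements, and let $\mathcal{Q}_P\subset\mathbb{R}^d$ be the associated convex polytope (defined in the context). Then $\mathcal{Q}_P$ is a Fano polytope.
   Context: Let $P=\{y_1,\ldots,y_d\}$ be a finite partially ordered set with $d$ elements and $\hat P=P\cup\{\hat 0,\hat 1\}$, where $\hat 0\notin P$ is adjoined as the unique minimal element and $\hat 1\notin P$ as the unique maximal element of $\hat P$. Write $y_0=\hat 0$, $y_{d+1}=\hat 1$. An edge of $\hat P$ is an edge of the Hasse diagram of $\hat P$, i.e. a pair $\{y_i,y_j\}$ with $y_i<y_j$ in $\hat P$ and no $z\in P$ with $y_i<z<y_j$. Let $\mathbf{e}_i$ be the $i$th canonical unit coordinate vector of $\mathbb{R}^d$. For an edge $e=\{y_i,y_j\}$ of $\hat P$ with $y_i<y_j$, define $\rho(e)\in\mathbb{R}^d$ by $\rho(e)=\mathbf{e}_i$ if $j=d+1$; $\rho(e)=-\mathbf{e}_j$ if $i=0$; $\rho(e)=\mathbf{e}_i-\mathbf{e}_j$ if $1\le i,j\le d$. The polytope $\mathcal{Q}_P\subset\mathbb{R}^d$ is the convex hull of $\{\rho(e): e \text{ is an edge of } \hat P\}$. An integral polytope is a convex polytope all of whose vertices have integer coordinates. A Fano polytope in $\mathbb{R}^d$ is an integral convex polytope of dimension $d$ such that the origin is the unique integer point belonging to its interior. *)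

theory Defs
  imports "HOL-Analysis.Analysis"
begin

text \<open>
  A poset is a carrier \<open>P\<close> with \<open>(a, b) \<in> r\<close> meaning \<open>a \<le> b\<close>. The labelling
  \<open>P = {y\<^sub>1, \<dots>, y\<^sub>d}\<close> is a bijection \<open>y\<close> from a finite index type \<open>'n\<close> with
  \<open>CARD('n) = d\<close> onto \<open>P\<close>, and the ambient space is \<open>real ^ 'n\<close>.
\<close>

datatype 'a hat = Zero_hat | Elem 'a | One_hat

definition hat_carrier :: "'a set \<Rightarrow> 'a hat set" where
  "hat_carrier P = {Zero_hat, One_hat} \<union> Elem ` P"

definition hat_order :: "'a set \<Rightarrow> 'a rel \<Rightarrow> 'a hat rel" where
  "hat_order P r =
     {(Zero_hat, x) | x. x \<in> hat_carrier P} \<union>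
     {(x, One_hat) | x. x \<in> hat_carrier P} \<union>
     {(Elem a, Elem b) | a b. (a, b) \<in> r}"

lemma partial_order_on_hat_order:
  assumes "partial_order_on P r"
  shows "partial_order_on (hat_carrier P) (hat_order P r)"
proof -
  have r: "r \<subseteq> P \<times> P" "\<And>a. a \<in> P \<Longrightarrow> (a, a) \<in> r" "trans r" "antisym r"
    using assms by (auto simp: partial_order_on_def preorder_on_def refl_on_def)
  show ?thesis
    unfolding partial_order_on_def preorder_on_def
  proof (intro conjI)
    show "hat_order P r \<subseteq> hat_carrier P \<times> hat_carrier P"
      using r(1) by (auto simp: hat_order_def hat_carrier_def)
    show "refl_on (hat_carrier P) (hat_order P r)"
      using r(2) by (auto simp: refl_on_def hat_order_def hat_carrier_def)
    show "trans (hat_order P r)"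
      using r(1) by (intro transI) (auto simp: hat_order_def hat_carrier_def intro: transD[OF r(3)])
    show "antisym (hat_order P r)"
      by (intro antisymI) (auto simp: hat_order_def intro: antisymD[OF r(4)])
  qed
qed

definition hat_less :: "'a set \<Rightarrow> 'a rel \<Rightarrow> 'a hat \<Rightarrow> 'a hat \<Rightarrow> bool" where
  "hat_less P r u v \<longleftrightarrow> (u, v) \<in> hat_order P r \<and> u \<noteq> v"

text \<open>An edge is represented by the pair (lower endpoint, upper endpoint).\<close>

definition hat_edges :: "'a set \<Rightarrow> 'a rel \<Rightarrow> ('a hat \<times> 'a hat) set" where
  "hat_edges P r =
     {(u, v). hat_less P r u v \<and> \<not> (\<exists>p\<in>P. hat_less P r u (Elem p) \<and> hat_less P r (Elem p) v)}"

text \<open>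
  \<open>inv y a\<close> is the index of \<open>a\<close>. The last equation only concerns pairs that are not edges:
  \<open>(Zero_hat, One_hat)\<close> is not an edge when \<open>P\<close> is nonempty.
\<close>

fun rho :: "('n::finite \<Rightarrow> 'a) \<Rightarrow> 'a hat \<times> 'a hat \<Rightarrow> real ^ 'n" where
  "rho y (Elem a, One_hat) = axis (inv y a) 1"
| "rho y (Zero_hat, Elem b) = - axis (inv y b) 1"
| "rho y (Elem a, Elem b) = axis (inv y a) 1 - axis (inv y b) 1"
| "rho y _ = 0"

definition Q_polytope :: "'a set \<Rightarrow> 'a rel \<Rightarrow> ('n::finite \<Rightarrow> 'a) \<Rightarrow> (real ^ 'n) set" where
  "Q_polytope P r y = convex hull (rho y ` hat_edges P r)"

definition integer_point :: "real ^ 'n \<Rightarrow> bool" where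
  "integer_point x \<longleftrightarrow> (\<forall>i. x $ i \<in> \<int>)"

definition integral_polytope :: "(real ^ 'n) set \<Rightarrow> bool" where
  "integral_polytope Q \<longleftrightarrow> polytope Q \<and> (\<forall>v. v extreme_point_of Q \<longrightarrow> integer_point v)"

definition fano_polytope :: "(real ^ 'n) set \<Rightarrow> bool" where
  "fano_polytope Q \<longleftrightarrow>
     integral_polytope Q \<and> aff_dim Q = int CARD('n) \<and> {x \<in> interior Q. integer_point x} = {0}"

end

theory Submission imports Defs begin

text \<open>
  Integrality is immediate, since an extreme point of a convex hull belongs to the
  generating set and the coordinates of every \<open>rho\<close> vector are among \<open>-1, 0, 1\<close>. For the same
  reason \<open>Q_polytope P r y\<close> lies in the cube \<open>[-1, 1]\<^sup>d\<close>, whose interior contains no integer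
  point other than the origin (\<open>interior_Q_integer_imp_zero\<close>).

  The point is therefore that the origin is interior; this also gives full dimension. If it were
  not, a nonzero functional \<open>c\<close> would be nonpositive on all edge vectors
  (\<open>separating_hyperplane_not_interior\<close>). Read
  \<open>c\<close> as a function on the extended poset with value \<open>0\<close> at both ends. The pairing of \<open>c\<close> with the
  vector of an edge is the value at the lower endpoint minus the value at the upper one, so the
  function is nondecreasing along edges and hence monotone, every relation in a finite poset being
  a chain of covering relations (\<open>hat_less_mono_of_edges\<close>). Every element is squeezed between
  the two ends, where the value is \<open>0\<close>, which forces \<open>c = 0\<close>
  (\<open>edge_nonpos_imp_zero\<close>).
\<close>

lemma hat_less_trans:
  assumes "partial_order_on P r" "hat_less P r u v" "hat_less P r v w"
  shows "hat_less P r u w"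
proof -
  have "trans (hat_order P r)" "antisym (hat_order P r)"
    using partial_order_on_hat_order[OF assms(1)]
    by (auto simp: partial_order_on_def preorder_on_def)
  then show ?thesis
    using assms(2,3) unfolding hat_less_def by (meson antisymD transD)
qed

text \<open>
  Finiteness enters here: if \<open>u < v\<close> is not an edge, some \<open>p\<close> lies strictly between, and the open
  intervals below and above \<open>p\<close> both omit \<open>p\<close>, so they are smaller than the one between \<open>u\<close> and
  \<open>v\<close>.
\<close>

lemma hat_less_mono_of_edges:
  fixes f :: "'a hat \<Rightarrow> real"
  assumes po: "partial_order_on P r" and fin: "finite P"
    and edge: "\<And>u v. (u, v) \<in> hat_edges P r \<Longrightarrow> f u \<le> f v"
    and "hat_less P r u v"
  shows "f u \<le> f v"
  using \<open>hat_less P r u v\<close>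
proof (induction "card {p \<in> P. hat_less P r u (Elem p) \<and> hat_less P r (Elem p) v}"
    arbitrary: u v rule: less_induct)
  case less
  define I where
    "I u v = {p \<in> P. hat_less P r u (Elem p) \<and> hat_less P r (Elem p) v}" for u v
  have fin_I: "finite (I u v)"
    using fin by (simp add: I_def)
  show ?case
  proof (cases "(u, v) \<in> hat_edges P r")
    case True
    then show ?thesis by (rule edge)
  next
    case False
    then obtain p where p: "p \<in> P" "hat_less P r u (Elem p)" "hat_less P r (Elem p) v"
      using less.prems by (auto simp: hat_edges_def)
    have irrefl: "\<not> hat_less P r w w" for w
      by (simp add: hat_less_def)
    have "I u (Elem p) \<subseteq> I u v - {p}" "I (Elem p) v \<subseteq> I u v - {p}"
      using p irrefl hat_less_trans[OF po] unfolding I_def by blast+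
    moreover have "p \<in> I u v"
      using p by (simp add: I_def)
    ultimately have "card (I u (Elem p)) < card (I u v)" "card (I (Elem p) v) < card (I u v)"
      using fin_I by (meson card_Diff1_less card_mono finite_Diff le_less_trans)+
    then show ?thesis
      using less.hyps[of u "Elem p"] less.hyps[of "Elem p" v] p unfolding I_def by linarith
  qed
qed

lemma edge_nonpos_imp_zero:
  fixes y :: "'n::finite \<Rightarrow> 'a" and c :: "real ^ 'n"
  assumes po: "partial_order_on P r" and bij: "bij_betw y UNIV P"
    and nonpos: "\<And>e. e \<in> hat_edges P r \<Longrightarrow> c \<bullet> rho y e \<le> 0"
  shows "c = 0"
proof -
  define f where
    "f u = (case u of Elem a \<Rightarrow> c $ inv y a | Zero_hat \<Rightarrow> 0 | One_hat \<Rightarrow> 0)" for u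
  have inj: "inj y" and range: "y i \<in> P" for i
    using bij by (auto simp: bij_betw_def)
  have fin: "finite P"
    using bij_betw_finite[OF bij] by simp
  have f_edge: "f u \<le> f v" if e: "(u, v) \<in> hat_edges P r" for u v
    using nonpos[OF e] e
    by (cases u; cases v)
      (auto simp: f_def inner_axis inner_diff_right hat_edges_def hat_less_def hat_order_def)
  have "c $ i = 0" for i
  proof -
    have "hat_less P r Zero_hat (Elem (y i))" "hat_less P r (Elem (y i)) One_hat"
      using range by (auto simp: hat_less_def hat_order_def hat_carrier_def)
    then have "f Zero_hat \<le> f (Elem (y i))" "f (Elem (y i)) \<le> f One_hat"
      using hat_less_mono_of_edges[of P r f, OF po fin f_edge] by auto
    then show ?thesis
      using inj by (simp add: f_def)
  qed
  then show ?thesis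
    by (simp add: vec_eq_iff)
qed

text \<open>
  Separating only the interior from the origin is enough when the interior is nonempty, because
  it is then dense in \<open>S\<close> and the closed half-space contains its closure. When the
  interior is empty, \<open>S\<close> lies in a hyperplane, and one of the two normal vectors of that
  hyperplane has the right sign.
\<close>

lemma separating_hyperplane_not_interior:
  fixes S :: "'b::euclidean_space set"
  assumes "convex S" "0 \<notin> interior S"
  obtains c where "c \<noteq> 0" "\<And>x. x \<in> S \<Longrightarrow> c \<bullet> x \<le> 0"
proof (cases "interior S = {}")
  case True
  then obtain a b where a: "a \<noteq> 0" "S \<subseteq> {x. a \<bullet> x = b}"
    using empty_interior_subset_hyperplane[OF assms(1)] by metis
  show thesis
  proof (cases "b \<le> 0")
    case True
    then show thesis using a by (intro that[of a]) auto
  next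
    case False
    then show thesis using a by (intro that[of "- a"]) auto
  qed
next
  case False
  obtain a where a: "a \<noteq> 0" "\<forall>x\<in>interior S. 0 \<le> a \<bullet> x"
    using separating_hyperplane_set_0[of "interior S"] assms by (auto simp: convex_interior)
  have "closure (interior S) \<subseteq> {x. 0 \<le> a \<bullet> x}"
    using a(2) by (intro closure_minimal closed_halfspace_ge) auto
  then have "S \<subseteq> {x. 0 \<le> a \<bullet> x}"
    using convex_closure_interior[OF assms(1) False] closure_subset[of S] by simp
  then show thesis
    using a(1) by (intro that[of "- a"]) auto
qed

lemma rho_component:
  "rho y e $ i \<in> {-1, 0, 1}"
  by (cases "(y, e)" rule: rho.cases) (auto simp: axis_def)

lemma finite_hat_edges:
  assumes "partial_order_on P r" "finite P"
  shows "finite (hat_edges P r)"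
proof (rule finite_subset)
  show "hat_edges P r \<subseteq> hat_carrier P \<times> hat_carrier P"
    using partial_order_on_hat_order[OF assms(1)]
    by (auto simp: hat_edges_def hat_less_def partial_order_on_def preorder_on_def)
  show "finite (hat_carrier P \<times> hat_carrier P)"
    using assms(2) by (simp add: hat_carrier_def)
qed

lemma Q_polytope_subset_cube:
  "Q_polytope P r y \<subseteq> cbox (- 1) 1"
proof -
  have "- 1 \<le> rho y e $ i" "rho y e $ i \<le> 1" for e i
    using rho_component[of y e i] by auto
  then have "rho y e \<in> cbox (- 1) 1" for e
    by (simp add: mem_box_cart)
  then show ?thesis
    unfolding Q_polytope_def by (intro hull_minimal) auto
qed

lemma interior_Q_integer_imp_zero:
  assumes "x \<in> interior (Q_polytope P r y)" "integer_point x"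
  shows "x = 0"
proof -
  have "x \<in> box (- 1) 1"
    using assms(1) interior_mono[OF Q_polytope_subset_cube[of P r y]] by auto
  then have bound: "- 1 < x $ i" "x $ i < 1" for i
    by (auto simp: mem_box_cart)
  have "x $ i = 0" for i
  proof -
    obtain k where "x $ i = of_int k"
      using assms(2) unfolding integer_point_def by (meson Ints_cases)
    with bound[of i] show ?thesis by simp
  qed
  then show ?thesis by (simp add: vec_eq_iff)
qed

lemma zero_in_interior_Q:
  assumes "partial_order_on P r" "bij_betw y UNIV P"
  shows "0 \<in> interior (Q_polytope P r y)"
proof (rule ccontr)
  assume "0 \<notin> interior (Q_polytope P r y)"
  then obtain c where "c \<noteq> 0" and c: "\<And>x. x \<in> Q_polytope P r y \<Longrightarrow> c \<bullet> x \<le> 0"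
    using separating_hyperplane_not_interior unfolding Q_polytope_def
    by (metis convex_convex_hull)
  have "c \<bullet> rho y e \<le> 0" if "e \<in> hat_edges P r" for e
    using that by (intro c) (simp add: Q_polytope_def hull_inc)
  then show False
    using edge_nonpos_imp_zero[OF assms] \<open>c \<noteq> 0\<close> by blast
qed

theorem lemma1p3:
  fixes P :: "'a set" and r :: "'a rel" and y :: "'n::finite \<Rightarrow> 'a"
  assumes "partial_order_on P r"
    and "bij_betw y UNIV P"
  shows "fano_polytope (Q_polytope P r y)"
  unfolding fano_polytope_def integral_polytope_def
proof (intro conjI allI impI)
  let ?Q = "Q_polytope P r y"
  have "finite P"
    using bij_betw_finite[OF assms(2)] by simp
  then show "polytope ?Q"
    unfolding Q_polytope_def polytope_def using finite_hat_edges[OF assms(1)] by blast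
  show "integer_point v" if v: "v extreme_point_of ?Q" for v
  proof -
    obtain e where "v = rho y e"
      using extreme_point_of_convex_hull[OF v[unfolded Q_polytope_def]] by blast
    then show ?thesis
      unfolding integer_point_def
      using rho_component[of y e] by (metis Ints_0 Ints_1 Ints_minus empty_iff insert_iff)
  qed
  show "aff_dim ?Q = int CARD('n)"
    using zero_in_interior_Q[OF assms] aff_dim_nonempty_interior[of ?Q] by auto
  show "{x \<in> interior ?Q. integer_point x} = {0}"
    using zero_in_interior_Q[OF assms] interior_Q_integer_imp_zero[of _ P r y]
    by (auto simp: integer_point_def)
qed

end
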